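(* Let $(E,[\cdot])$ and $(E',[\cdot])$ be closure spaces, and let $\varphi : E \to E'$ and $\psi : E' \to E$ be maps. Then the following are equivalent: (1) $(\varphi,\psi)$ is a Galois connection between the closure spaces $E$ and $E'$, i.e. $\varphi^{-1}([A']) = [\psi(A')]$ for all subsets $A'$ of $E'$; (2) $\varphi$ and $\psi$ are continuous and $(\varphi,\psi)$ is a Galois connection between the qosets $E$ and $E'$ equipped with their respective specialization orders; (3) $\varphi$ and $\psi$ are continuous and $(\varphi^{-1},\psi^{-1})$ is a Galois connection between the posets $\mathcal{F}(E')$ and $\mathcal{F}(E)$, where $\varphi^{-1} : \mathcal{F}(E') \to \mathcal{F}(E)$ and $\psi^{-1} : \mathcal{F}(E) \to \mathcal{F}(E')$ are the inverse image maps.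
   Context: A qoset $(P,\leqslant)$ is a set $P$ with a reflexive and transitive binary relation $\leqslant$; it is a poset if moreover $\leqslant$ is antisymmetric. A Galois connection between qosets $P$ and $P'$ is a pair $(\varphi,\psi)$ of maps $\varphi : P \to P'$ and $\psi : P' \to P$ such that $\varphi(x) \leqslant x'$ if and only if $x \leqslant \psi(x')$, for all $x \in P$, $x' \in P'$. A closure space $(E,[\cdot])$ is a set $E$ equipped with a map $[\cdot] : 2^E \to 2^E$ (a closure operator) such that $A \subseteq [[A]] \subseteq [B]$ for all subsets $A, B$ of $E$ with $A \subseteq B$. A subset $F$ of $E$ is closed if $[F] = F$. The empty set is not assumed to be closed. The closure operators of both $E$ and $E'$ are denoted $[\cdot]$. The specialization order on $(E,[\cdot])$ is the quasiorder defined by $x \leqslant y$ if $x \in [y]$, where $[y]$ stands for $[\{y\}]$. A map $f : E \to E'$ between closure spaces is continuous if $f([A]) \subseteq [f(A)]$ for all subsets $A$ of $E$; equivalently, $f^{-1}(F')$ is closed in $E$ for every closed subset $F'$ of $E'$. For a closure space $E$, $\mathcal{F}(E)$ denotes the poset of closed subsets of $E$, ordered by inclusion. When $\varphi$ and $\psi$ are continuous, the inverse image maps $\varphi^{-1} : \mathcal{F}(E') \to \mathcal{F}(E)$ and $\psi^{-1} : \mathcal{F}(E) \to \mathcal{F}(E')$ are well defined. *)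

theory Defs
  imports Main "HOL-Library.FuncSet"
begin

text \<open>
  Spaces live on explicit carrier sets, so only the values of \<^term>\<open>cl\<close> on subsets of the carrier
  matter. The empty set need not be closed.
\<close>

locale closure_space =
  fixes E :: "'a set" and cl :: "'a set \<Rightarrow> 'a set"
  assumes cl_in_Pow: "cl \<in> Pow E \<rightarrow> Pow E"
    and cl_axiom: "\<And>A B. A \<subseteq> B \<Longrightarrow> B \<subseteq> E \<Longrightarrow> A \<subseteq> cl (cl A) \<and> cl (cl A) \<subseteq> cl B"

definition specialization :: "'a set \<Rightarrow> ('a set \<Rightarrow> 'a set) \<Rightarrow> 'a rel" where
  "specialization E cl = {(x, y). x \<in> E \<and> y \<in> E \<and> x \<in> cl {y}}"

definition closed_sets :: "'a set \<Rightarrow> ('a set \<Rightarrow> 'a set) \<Rightarrow> 'a set set" where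
  "closed_sets E cl = {F. F \<subseteq> E \<and> cl F = F}"

definition inclusion_on :: "'a set set \<Rightarrow> 'a set rel" where
  "inclusion_on \<C> = {(F, G). F \<in> \<C> \<and> G \<in> \<C> \<and> F \<subseteq> G}"

definition cl_continuous ::
  "'a set \<Rightarrow> ('a set \<Rightarrow> 'a set) \<Rightarrow> 'b set \<Rightarrow> ('b set \<Rightarrow> 'b set) \<Rightarrow> ('a \<Rightarrow> 'b) \<Rightarrow> bool" where
  "cl_continuous E cl E' cl' f \<longleftrightarrow> f \<in> E \<rightarrow> E' \<and> (\<forall>A. A \<subseteq> E \<longrightarrow> f ` cl A \<subseteq> cl' (f ` A))"

text \<open>A qoset is a set with a relation on it satisfying \<^const>\<open>preorder_on\<close>.\<close>

definition qoset_galois ::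
  "'a set \<Rightarrow> 'a rel \<Rightarrow> 'b set \<Rightarrow> 'b rel \<Rightarrow> ('a \<Rightarrow> 'b) \<Rightarrow> ('b \<Rightarrow> 'a) \<Rightarrow> bool" where
  "qoset_galois P r P' r' \<phi> \<psi> \<longleftrightarrow>
     preorder_on P r \<and> preorder_on P' r' \<and> \<phi> \<in> P \<rightarrow> P' \<and> \<psi> \<in> P' \<rightarrow> P \<and>
     (\<forall>x\<in>P. \<forall>x'\<in>P'. (\<phi> x, x') \<in> r' \<longleftrightarrow> (x, \<psi> x') \<in> r)"

definition closure_galois ::
  "'a set \<Rightarrow> ('a set \<Rightarrow> 'a set) \<Rightarrow> 'b set \<Rightarrow> ('b set \<Rightarrow> 'b set) \<Rightarrow> ('a \<Rightarrow> 'b) \<Rightarrow> ('b \<Rightarrow> 'a) \<Rightarrow> bool" where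
  "closure_galois E cl E' cl' \<phi> \<psi> \<longleftrightarrow>
     \<phi> \<in> E \<rightarrow> E' \<and> \<psi> \<in> E' \<rightarrow> E \<and>
     (\<forall>A'. A' \<subseteq> E' \<longrightarrow> \<phi> -` cl' A' \<inter> E = cl (\<psi> ` A'))"

context closure_space
begin

lemma cl_subset: "A \<subseteq> E \<Longrightarrow> cl A \<subseteq> E"
  using cl_in_Pow by blast

lemma cl_cl_subset: "A \<subseteq> E \<Longrightarrow> cl (cl A) \<subseteq> cl A"
  using cl_axiom[of A A] by blast

lemma cl_increasing: "A \<subseteq> E \<Longrightarrow> A \<subseteq> cl A"
  using cl_axiom[of A A] by blast

lemma cl_idem: "A \<subseteq> E \<Longrightarrow> cl (cl A) = cl A"
  by (meson cl_cl_subset cl_increasing cl_subset subset_antisym)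

lemma cl_mono: "A \<subseteq> B \<Longrightarrow> B \<subseteq> E \<Longrightarrow> cl A \<subseteq> cl B"
  using cl_axiom[of A B] cl_idem[of A] by blast

lemma preorder_on_specialization: "preorder_on E (specialization E cl)"
  unfolding preorder_on_def
proof (intro conjI)
  show "specialization E cl \<subseteq> E \<times> E"
    by (auto simp: specialization_def)
  show "refl_on E (specialization E cl)"
    using cl_increasing by (auto simp: refl_on_def specialization_def)
  show "trans (specialization E cl)"
  proof (rule transI)
    fix x y z assume "(x, y) \<in> specialization E cl" "(y, z) \<in> specialization E cl"
    then have *: "x \<in> E" "y \<in> E" "z \<in> E" "x \<in> cl {y}" "y \<in> cl {z}"
      by (auto simp: specialization_def)
    then have "cl {y} \<subseteq> cl (cl {z})"
      using cl_mono[of "{y}" "cl {z}"] cl_subset[of "{z}"] by blast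
    then show "(x, z) \<in> specialization E cl"
      using * cl_idem[of "{z}"] by (auto simp: specialization_def)
  qed
qed

end

lemma partial_order_on_inclusion_on: "partial_order_on \<C> (inclusion_on \<C>)"
  by (auto simp: partial_order_on_def preorder_on_def refl_on_def trans_def antisym_def
      inclusion_on_def)

end

theory Submission
  imports Defs
begin

text \<open>
  Write (1) as \<^term>\<open>\<phi> -` cl' A' \<inter> E = cl (\<psi> ` A')\<close>. Applied to singletons it is the adjunction of the
  specialization orders, and since a closed set contains \<^term>\<open>cl (\<psi> ` F')\<close> as soon as it contains
  \<^term>\<open>\<psi> ` F'\<close>, applied to closed sets it is the adjunction of the inverse images.
  Conversely, let both maps be continuous. The right-hand side lies in the left-hand side by the
  counit of the first adjunction, or by the unit of the second; the opposite inclusion follows from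
  the unit of the first, or from the counit of the second.
\<close>

context closure_space
begin

lemma cl_closed: "A \<subseteq> E \<Longrightarrow> cl A \<in> closed_sets E cl"
  by (simp add: closed_sets_def cl_subset cl_idem)

lemma cl_least: "F \<in> closed_sets E cl \<Longrightarrow> A \<subseteq> F \<Longrightarrow> cl A \<subseteq> F"
  using cl_mono[of A F] by (auto simp: closed_sets_def)

lemma cl_subset_closed_iff:
  "F \<in> closed_sets E cl \<Longrightarrow> A \<subseteq> E \<Longrightarrow> cl A \<subseteq> F \<longleftrightarrow> A \<subseteq> F"
  using cl_least cl_increasing by blast

end

locale closure_space_pair = X: closure_space E cl + Y: closure_space E' cl'
  for E :: "'a set" and cl and E' :: "'b set" and cl'
begin

text \<open>If \<open>A\<close> is the preimage of a closed \<open>F'\<close>, then \<open>f\<close>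
  maps \<open>cl A\<close> into the closure of a subset of \<open>F'\<close>, hence into
  \<open>F'\<close>, so \<open>cl A\<close> stays within \<open>A\<close>. Conversely, the preimage
  of the closure of the image of \<open>A\<close> is a closed set containing \<open>A\<close>, so it
  contains \<open>cl A\<close>.\<close>

lemma cl_continuous_iff_vimage_closed:
  assumes "f \<in> E \<rightarrow> E'"
  shows "cl_continuous E cl E' cl' f \<longleftrightarrow>
    (\<forall>F'\<in>closed_sets E' cl'. f -` F' \<inter> E \<in> closed_sets E cl)"
proof
  assume cont: "cl_continuous E cl E' cl' f"
  show "\<forall>F'\<in>closed_sets E' cl'. f -` F' \<inter> E \<in> closed_sets E cl"
  proof
    fix F' assume F': "F' \<in> closed_sets E' cl'"
    let ?A = "f -` F' \<inter> E"
    have "f ` cl ?A \<subseteq> cl' (f ` ?A)"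
      using cont by (simp add: cl_continuous_def)
    also have "\<dots> \<subseteq> F'"
      using F' by (intro Y.cl_least) auto
    finally have "cl ?A \<subseteq> ?A"
      using X.cl_subset[of ?A] by blast
    then show "?A \<in> closed_sets E cl"
      using X.cl_increasing[of ?A] by (auto simp: closed_sets_def)
  qed
next
  assume closed: "\<forall>F'\<in>closed_sets E' cl'. f -` F' \<inter> E \<in> closed_sets E cl"
  have "f ` cl A \<subseteq> cl' (f ` A)" if "A \<subseteq> E" for A
  proof -
    have fA: "f ` A \<subseteq> E'"
      using assms that by blast
    have "cl A \<subseteq> f -` cl' (f ` A) \<inter> E"
      using closed Y.cl_closed[OF fA] Y.cl_increasing[OF fA] that by (intro X.cl_least) auto
    then show ?thesis by blast
  qed
  with assms show "cl_continuous E cl E' cl' f"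
    by (simp add: cl_continuous_def)
qed

text \<open>The hypothesis exhibits the preimage under \<open>\<phi>\<close> of a closed set as a
  closure, hence as a closed set.\<close>

lemma closure_galois_imp_continuous:
  assumes "closure_galois E cl E' cl' \<phi> \<psi>"
  shows "cl_continuous E cl E' cl' \<phi>" and "cl_continuous E' cl' E cl \<psi>"
proof -
  have \<phi>: "\<phi> \<in> E \<rightarrow> E'" and \<psi>: "\<psi> \<in> E' \<rightarrow> E"
    and eq: "\<And>A'. A' \<subseteq> E' \<Longrightarrow> \<phi> -` cl' A' \<inter> E = cl (\<psi> ` A')"
    using assms by (auto simp: closure_galois_def)
  have "\<phi> -` F' \<inter> E \<in> closed_sets E cl" if "F' \<in> closed_sets E' cl'" for F'
  proof -
    have "F' \<subseteq> E'" "cl' F' = F'"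
      using that by (auto simp: closed_sets_def)
    moreover from this have "\<psi> ` F' \<subseteq> E"
      using \<psi> by blast
    ultimately show ?thesis
      using eq[of F'] X.cl_closed[of "\<psi> ` F'"] by simp
  qed
  then show "cl_continuous E cl E' cl' \<phi>"
    by (simp add: cl_continuous_iff_vimage_closed[OF \<phi>])
  have "\<psi> ` cl' A' \<subseteq> cl (\<psi> ` A')" if A': "A' \<subseteq> E'" for A'
  proof -
    \<comment> \<open>The Galois identity is used at \<open>cl' A'\<close> and then at
      \<open>A'\<close>: the left-hand sides agree by idempotence of \<open>cl'\<close>, so the
      images of both sets under \<open>\<psi>\<close> have the same closure.\<close>
    have "\<psi> ` cl' A' \<subseteq> cl (\<psi> ` cl' A')"
      using \<psi> Y.cl_subset[OF A'] by (intro X.cl_increasing) blast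
    also have "\<dots> = \<phi> -` cl' (cl' A') \<inter> E"
      using eq Y.cl_subset[OF A'] by simp
    also have "\<dots> = cl (\<psi> ` A')"
      using eq A' by (simp add: Y.cl_idem)
    finally show ?thesis .
  qed
  with \<psi> show "cl_continuous E' cl' E cl \<psi>"
    by (simp add: cl_continuous_def)
qed

lemma closure_galois_imp_specialization:
  assumes "closure_galois E cl E' cl' \<phi> \<psi>"
  shows "qoset_galois E (specialization E cl) E' (specialization E' cl') \<phi> \<psi>"
proof -
  have \<phi>: "\<phi> \<in> E \<rightarrow> E'" and \<psi>: "\<psi> \<in> E' \<rightarrow> E"
    using assms by (auto simp: closure_galois_def)
  have "\<phi> -` cl' {x'} \<inter> E = cl {\<psi> x'}" if "x' \<in> E'" for x'
    using assms that by (auto simp: closure_galois_def dest: spec[of _ "{x'}"])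
  then have "(\<phi> x, x') \<in> specialization E' cl' \<longleftrightarrow> (x, \<psi> x') \<in> specialization E cl"
    if "x \<in> E" "x' \<in> E'" for x x'
    using that \<phi> \<psi> by (auto simp: specialization_def)
  with \<phi> \<psi> show ?thesis
    by (simp add: qoset_galois_def X.preorder_on_specialization Y.preorder_on_specialization)
qed

lemma specialization_galois_imp_closure_galois:
  assumes \<phi>: "cl_continuous E cl E' cl' \<phi>" and \<psi>: "cl_continuous E' cl' E cl \<psi>"
    and gal: "qoset_galois E (specialization E cl) E' (specialization E' cl') \<phi> \<psi>"
  shows "closure_galois E cl E' cl' \<phi> \<psi>"
proof -
  have maps: "\<phi> \<in> E \<rightarrow> E'" "\<psi> \<in> E' \<rightarrow> E"
    using gal by (auto simp: qoset_galois_def)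
  have adj: "\<phi> x \<in> cl' {x'} \<longleftrightarrow> x \<in> cl {\<psi> x'}" if "x \<in> E" "x' \<in> E'" for x x'
    using gal that maps by (auto simp: qoset_galois_def specialization_def)
  have "\<phi> -` cl' A' \<inter> E = cl (\<psi> ` A')" if A': "A' \<subseteq> E'" for A'
  proof
    have \<psi>A': "\<psi> ` A' \<subseteq> E"
      using maps A' by blast
    have \<psi>cl: "\<psi> ` cl' A' \<subseteq> cl (\<psi> ` A')"
      using \<psi> A' by (simp add: cl_continuous_def)
    show "\<phi> -` cl' A' \<inter> E \<subseteq> cl (\<psi> ` A')"
    proof
      fix x assume x: "x \<in> \<phi> -` cl' A' \<inter> E"
      then have "\<phi> x \<in> E'"
        using maps by blast
      \<comment> \<open>The unit at \<open>x\<close>: the adjunction with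
        \<open>x' = \<phi> x\<close>. Continuity of \<open>\<psi>\<close> then puts
        \<open>\<psi> (\<phi> x)\<close> in the closure of the image of \<open>A'\<close>, because
        \<open>\<phi> x\<close> lies in \<open>cl' A'\<close>.\<close>
      then have "x \<in> cl {\<psi> (\<phi> x)}"
        using x adj[of x "\<phi> x"] Y.cl_increasing[of "{\<phi> x}"] by simp
      also have "\<dots> \<subseteq> cl (\<psi> ` A')"
        using x \<psi>cl by (intro X.cl_least X.cl_closed[OF \<psi>A']) blast
      finally show "x \<in> cl (\<psi> ` A')" .
    qed
    show "cl (\<psi> ` A') \<subseteq> \<phi> -` cl' A' \<inter> E"
    \<comment> \<open>The right-hand side is closed by continuity of \<open>\<phi>\<close>, so only
      the points \<open>\<psi> x'\<close> with \<open>x'\<close> in \<open>A'\<close> need checking.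
      For these the counit gives \<open>\<phi> (\<psi> x') \<in> cl' {x'}\<close>.\<close>
    proof (rule X.cl_least)
      show "\<phi> -` cl' A' \<inter> E \<in> closed_sets E cl"
        using \<phi> Y.cl_closed[OF A'] by (simp add: cl_continuous_iff_vimage_closed[OF maps(1)])
      have "\<phi> (\<psi> x') \<in> cl' A'" if "x' \<in> A'" for x'
        using that \<psi>A' A' adj[of "\<psi> x'" x'] X.cl_increasing[of "{\<psi> x'}"] Y.cl_mono[of "{x'}" A']
        by blast
      then show "\<psi> ` A' \<subseteq> \<phi> -` cl' A' \<inter> E"
        using \<psi>A' by blast
    qed
  qed
  with maps show ?thesis
    by (simp add: closure_galois_def)
qed

text \<open>Continuity makes both inverse image maps preserve closedness, so the typing conditions
  of the Galois connection hold and its order relations reduce to plain inclusion.\<close>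

lemma vimage_galois_iff:
  assumes \<phi>: "cl_continuous E cl E' cl' \<phi>" and \<psi>: "cl_continuous E' cl' E cl \<psi>"
  shows "qoset_galois (closed_sets E' cl') (inclusion_on (closed_sets E' cl'))
      (closed_sets E cl) (inclusion_on (closed_sets E cl))
      (\<lambda>F'. \<phi> -` F' \<inter> E) (\<lambda>F. \<psi> -` F \<inter> E') \<longleftrightarrow>
    (\<forall>F'\<in>closed_sets E' cl'. \<forall>F\<in>closed_sets E cl.
      \<phi> -` F' \<inter> E \<subseteq> F \<longleftrightarrow> F' \<subseteq> \<psi> -` F \<inter> E')"
proof -
  \<comment> \<open>Exchanging the two spaces makes the preimage criterion for continuity available
    for \<open>\<psi>\<close>.\<close>
  interpret swap: closure_space_pair E' cl' E cl ..
  have "\<phi> -` F' \<inter> E \<in> closed_sets E cl" if "F' \<in> closed_sets E' cl'" for F'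
    using \<phi> that cl_continuous_iff_vimage_closed[of \<phi>] by (simp add: cl_continuous_def)
  moreover have "\<psi> -` F \<inter> E' \<in> closed_sets E' cl'" if "F \<in> closed_sets E cl" for F
    using \<psi> that swap.cl_continuous_iff_vimage_closed[of \<psi>] by (simp add: cl_continuous_def)
  ultimately show ?thesis
    using partial_order_on_inclusion_on[of "closed_sets E cl"]
      partial_order_on_inclusion_on[of "closed_sets E' cl'"]
    by (simp add: qoset_galois_def partial_order_on_def inclusion_on_def)
qed

text \<open>For closed \<open>F'\<close>, the Galois identity turns the preimage under
  \<open>\<phi>\<close> into the closure of the image under \<open>\<psi>\<close>. A closed
  \<open>F\<close> contains this closure iff it contains the image, and the adjunction of image and
  preimage under \<open>\<psi>\<close> concludes.\<close>

lemma closure_galois_iff_vimage_adjoint: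
  assumes \<phi>: "cl_continuous E cl E' cl' \<phi>" and \<psi>: "cl_continuous E' cl' E cl \<psi>"
  shows "closure_galois E cl E' cl' \<phi> \<psi> \<longleftrightarrow>
    (\<forall>F'\<in>closed_sets E' cl'. \<forall>F\<in>closed_sets E cl.
      \<phi> -` F' \<inter> E \<subseteq> F \<longleftrightarrow> F' \<subseteq> \<psi> -` F \<inter> E')"
    (is "_ \<longleftrightarrow> ?adjoint")
proof
  have maps: "\<phi> \<in> E \<rightarrow> E'" "\<psi> \<in> E' \<rightarrow> E"
    using \<phi> \<psi> by (auto simp: cl_continuous_def)
  {
    assume gal: "closure_galois E cl E' cl' \<phi> \<psi>"
    show ?adjoint
    proof (intro ballI)
      fix F' F assume F': "F' \<in> closed_sets E' cl'" and F: "F \<in> closed_sets E cl"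
      then have F'E': "F' \<subseteq> E'" and "cl' F' = F'"
        by (simp_all add: closed_sets_def)
      then have "\<phi> -` F' \<inter> E = cl (\<psi> ` F')"
        using gal F'E' unfolding closure_galois_def by (metis (no_types))
      moreover have "\<psi> ` F' \<subseteq> E"
        using maps F'E' by blast
      ultimately show "\<phi> -` F' \<inter> E \<subseteq> F \<longleftrightarrow> F' \<subseteq> \<psi> -` F \<inter> E'"
        using F'E' X.cl_subset_closed_iff[OF F, of "\<psi> ` F'"]
        by (simp only: image_subset_iff_subset_vimage Int_subset_iff simp_thms)
    qed
  next
    assume adj: ?adjoint
    have "\<phi> -` cl' A' \<inter> E = cl (\<psi> ` A')" if A': "A' \<subseteq> E'" for A'
    proof
      have \<psi>A': "\<psi> ` A' \<subseteq> E"
        using maps A' by blast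
      \<comment> \<open>Continuity of \<open>\<psi>\<close> is the right-hand side of the adjunction
        for the closed sets \<open>cl' A'\<close> and the closure of the image of \<open>A'\<close>;
        its left-hand side is the desired inclusion.\<close>
      have "\<psi> ` cl' A' \<subseteq> cl (\<psi> ` A')"
        using \<psi> A' by (simp add: cl_continuous_def)
      then have "cl' A' \<subseteq> \<psi> -` cl (\<psi> ` A') \<inter> E'"
        using Y.cl_subset[OF A'] by blast
      with adj[rule_format, OF Y.cl_closed[OF A'] X.cl_closed[OF \<psi>A']]
      show "\<phi> -` cl' A' \<inter> E \<subseteq> cl (\<psi> ` A')"
        by (rule iffD2)
      have closed: "\<phi> -` cl' A' \<inter> E \<in> closed_sets E cl"
        using \<phi> Y.cl_closed[OF A'] by (simp add: cl_continuous_iff_vimage_closed[OF maps(1)])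
      \<comment> \<open>The unit at \<open>cl' A'\<close>: choosing \<open>F\<close> to be the
        preimage of \<open>cl' A'\<close> under \<open>\<phi>\<close> makes the left-hand side of
        the adjunction reflexivity.\<close>
      have "cl' A' \<subseteq> \<psi> -` (\<phi> -` cl' A' \<inter> E) \<inter> E'"
        using adj[rule_format, OF Y.cl_closed[OF A'] closed] by (rule iffD1) (rule order_refl)
      then show "cl (\<psi> ` A') \<subseteq> \<phi> -` cl' A' \<inter> E"
        using Y.cl_increasing[OF A'] by (intro X.cl_least[OF closed]) blast
    qed
    with maps show "closure_galois E cl E' cl' \<phi> \<psi>"
      by (simp add: closure_galois_def)
  }
qed

end

theorem theorem3p3:
  fixes E :: "'a set" and cl :: "'a set \<Rightarrow> 'a set"
    and E' :: "'b set" and cl' :: "'b set \<Rightarrow> 'b set"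
    and \<phi> :: "'a \<Rightarrow> 'b" and \<psi> :: "'b \<Rightarrow> 'a"
  assumes "closure_space E cl" and "closure_space E' cl'"
    and "\<phi> \<in> E \<rightarrow> E'" and "\<psi> \<in> E' \<rightarrow> E"
  shows "(closure_galois E cl E' cl' \<phi> \<psi> \<longleftrightarrow>
            cl_continuous E cl E' cl' \<phi> \<and> cl_continuous E' cl' E cl \<psi> \<and>
            qoset_galois E (specialization E cl) E' (specialization E' cl') \<phi> \<psi>)
       \<and> (closure_galois E cl E' cl' \<phi> \<psi> \<longleftrightarrow>
            cl_continuous E cl E' cl' \<phi> \<and> cl_continuous E' cl' E cl \<psi> \<and>
            qoset_galois (closed_sets E' cl') (inclusion_on (closed_sets E' cl'))
              (closed_sets E cl) (inclusion_on (closed_sets E cl))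
              (\<lambda>F'. \<phi> -` F' \<inter> E) (\<lambda>F. \<psi> -` F \<inter> E'))"
proof -
  interpret closure_space_pair E cl E' cl'
    using assms(1,2) by (simp add: closure_space_pair_def)
  \<comment> \<open>What remains is propositional: the Galois identity implies continuity of both
    maps, which is what the lemmas on the inverse images presuppose.\<close>
  show ?thesis
    using closure_galois_imp_continuous[of \<phi> \<psi>] closure_galois_imp_specialization[of \<phi> \<psi>]
      specialization_galois_imp_closure_galois[of \<phi> \<psi>] closure_galois_iff_vimage_adjoint[of \<phi> \<psi>]
      vimage_galois_iff[of \<phi> \<psi>]
    by argo
qed

end
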